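(* Let $g_1,\dots,g_m\in\mathbb{R}[\mathbf{x}]=\mathbb{R}[x_1,\dots,x_n]$ and let $\mathbf{K}:=\{\mathbf{x}\in\mathbb{R}^n:g_j(\mathbf{x})\ge0,\ j=1,\dots,m\}$ be compact. Let $\{1,\dots,n\}=\bigcup_{i=1}^N I_i$ (with possible overlaps), let $g_{m+1},\dots,g_{m+N}$, the partition $\{1,\dots,m+N\}=\bigcup_{i=1}^N J_i$, the sets $\mathbf{K}_i$, the projections $\pi_{ij}$ and the index sets $U_i$ be as defined in the context, and let $p_i,q_i\in\mathbb{R}[x_k:k\in I_i]$ with $q_i>0$ on $\mathbf{K}$, $i=1,\dots,N$. Let $$f^*:=\inf_{\mathbf{x}\in\mathbf{K}}\ \sum_{i=1}^N\frac{p_i(\mathbf{x})}{q_i(\mathbf{x})}$$ and let $\hat f$ be the optimal value of the infinite-dimensional problem $$\hat f:=\inf_{\mu_i\in\mathcal{M}(\mathbf{K}_i),\ i=1,\dots,N}\ \sum_{i=1}^N\int_{\mathbf{K}_i}p_i\,d\mu_i$$ subject to $$\int_{\mathbf{K}_i}q_i\,d\mu_i=1,\quad i=1,\dots,N,\qquad \pi_{ij}(q_i\,d\mu_i)=\pi_{ji}(q_j\,d\mu_j),\quad\forall j\in U_i,\ i=1,\dots,N-1.$$ If the sparsity pattern $(I_i)_{i=1}^N$ satisfies the running intersection property, i.e. for every $i=2,\dots,N$, $$I_i\cap\Big(\bigcup_{k=1}^{i-1}I_k\Big)\subseteq I_j\quad\text{for some }j\le i-1,$$ then $\hat f=f^*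$.
   Context: $\mathbb{R}[x_k:k\in I_i]$ is the ring of polynomials in the variables $x_k$, $k\in I_i$, and $n_i:=|I_i|$. A number $M>0$ is known such that $\mathbf{x}\in\mathbf{K}\Rightarrow M-\|\mathbf{x}\|^2\ge0$, and for $i=1,\dots,N$ one sets $g_{m+i}(\mathbf{x}):=M-\sum_{k\in I_i}x_k^2$. The index set $\{1,\dots,m+N\}$ has a partition $\bigcup_{i=1}^N J_i$ with $J_i\ne\emptyset$ for every $i$, such that $g_j\in\mathbb{R}[x_k:k\in I_i]$ for every $j\in J_i$, $i=1,\dots,N$. For every $i$, $\mathbf{K}_i:=\{\mathbf{z}\in\mathbb{R}^{n_i}:g_k(\mathbf{z})\ge0,\ k\in J_i\}$ (coordinates of $\mathbf{z}$ indexed by $I_i$), so that $\mathbf{K}=\{\mathbf{x}\in\mathbb{R}^n:(x_k,k\in I_i)\in\mathbf{K}_i,\ i=1,\dots,N\}$. $\mathcal{M}(\mathbf{K}_i)$ denotes the space of finite (nonnegative) Borel measures on $\mathbf{K}_i$, and $q_i\,d\mu_i$ is the measure with density $q_i$ with respect to $\mu_i$. For $i\ne j$ with $I_i\cap I_j\ne\emptyset$, $\pi_{ij}$ maps a measure on $\mathbf{K}_i$ to its projection (marginal, i.e. push-forward under $(x_k,k\in I_i)\mapsto(x_k,k\in I_i\cap I_j)$) on the variables $x_k$, $k\in I_i\cap I_j$; $\pi_{ji}$ similarly maps a measure on $\mathbf{K}_j$ to its marginal on the same variables. For $i=1,\dots,N-1$, $U_i:=\{j\in\{i+1,\dots,N\}: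 I_i\cap I_j\ne\emptyset\}$.
   Formalization: The denominators q_i are assumed positive on all of K_i rather than only on K; with positivity on K alone the claim fails, since K_i may exceed the projection of K and mass of μ_i at zeros of q_i escapes all constraints. *)

theory Defs
  imports "HOL-Analysis.Analysis" "HOL-Library.Poly_Mapping"
begin

text \<open>
  Points of \<open>\<real>\<^sup>I\<close>, for a finite set \<open>I\<close> of variable indices, are the extensional
  functions \<open>I \<rightarrow>\<^sub>E UNIV\<close>; in particular \<open>\<real>\<^sup>n\<close> is \<open>{1..n} \<rightarrow>\<^sub>E UNIV\<close>. Its topology is
  \<open>product_topology (\<lambda>_. euclideanreal) I\<close> and its Borel sigma-algebra is that of
  \<open>Pi\<^sub>M I (\<lambda>_. borel)\<close>. The projection of \<open>\<real>\<^sup>I\<close> onto \<open>\<real>\<^sup>L\<close>, for \<open>L \<subseteq> I\<close>, is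
  \<open>\<lambda>x. restrict x L\<close>.
\<close>

text \<open>Real polynomials in variables indexed by \<open>nat\<close>: finitely supported maps from monomials
  (exponent vectors) to coefficients.\<close>

type_synonym rpoly = "(nat \<Rightarrow>\<^sub>0 nat) \<Rightarrow>\<^sub>0 real"

definition peval :: "rpoly \<Rightarrow> (nat \<Rightarrow> real) \<Rightarrow> real" where
  "peval p x = (\<Sum>a\<in>Poly_Mapping.keys p. Poly_Mapping.lookup p a *
      (\<Prod>k\<in>Poly_Mapping.keys a. x k ^ Poly_Mapping.lookup a k))"

text \<open>The subring \<open>\<real>[x\<^sub>k : k \<in> I]\<close>.\<close>

definition poly_ring :: "nat set \<Rightarrow> rpoly set" where
  "poly_ring I = {p. \<forall>a\<in>Poly_Mapping.keys p. Poly_Mapping.keys a \<subseteq> I}"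

text \<open>The polynomial \<open>M - (\<Sum>k\<in>I. x\<^sub>k\<^sup>2)\<close>.\<close>

definition ball_poly :: "real \<Rightarrow> nat set \<Rightarrow> rpoly" where
  "ball_poly M I = Poly_Mapping.single 0 M
      - (\<Sum>k\<in>I. Poly_Mapping.single (Poly_Mapping.single k 2) 1)"

definition basic_set :: "nat set \<Rightarrow> nat set \<Rightarrow> (nat \<Rightarrow> rpoly) \<Rightarrow> (nat \<Rightarrow> real) set" where
  "basic_set I J g = {z \<in> I \<rightarrow>\<^sub>E UNIV. \<forall>j\<in>J. peval (g j) z \<ge> 0}"

definition running_intersection :: "nat \<Rightarrow> (nat \<Rightarrow> nat set) \<Rightarrow> bool" where
  "running_intersection N I \<longleftrightarrow>
     (\<forall>i\<in>{2..N}. \<exists>j\<in>{1..i - 1}. I i \<inter> (\<Union>k\<in>{1..i - 1}. I k) \<subseteq> I j)"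

definition later_neighbours :: "nat \<Rightarrow> (nat \<Rightarrow> nat set) \<Rightarrow> nat \<Rightarrow> nat set" where
  "later_neighbours N I i = {j\<in>{i + 1..N}. I i \<inter> I j \<noteq> {}}"

text \<open>The finite Borel measures on a subset \<open>A\<close> of \<open>\<real>\<^sup>I\<close>; their space is \<open>A\<close>.\<close>

definition borel_measures :: "nat set \<Rightarrow> (nat \<Rightarrow> real) set \<Rightarrow> (nat \<Rightarrow> real) measure set" where
  "borel_measures I A =
     {\<mu>. finite_measure \<mu> \<and> sets \<mu> = sets (restrict_space (Pi\<^sub>M I (\<lambda>_. borel)) A)}"

text \<open>The measure \<open>q d\<mu>\<close>. Since \<open>ennreal\<close> truncates negative reals to \<open>0\<close>, this is the intended
  measure only where \<open>q\<close> is nonnegative on the space of \<open>\<mu>\<close>. This is why the denominators have to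
  be positive on all of \<open>K\<^sub>i\<close>, not merely on \<open>K\<close>: \<open>K\<^sub>i\<close> can be larger than the projection of \<open>K\<close>,
  and mass of \<open>\<mu>\<^sub>i\<close> at a zero of \<open>q\<^sub>i\<close> in \<open>K\<^sub>i\<close> is invisible to all the constraints.\<close>

definition weighted :: "rpoly \<Rightarrow> (nat \<Rightarrow> real) measure \<Rightarrow> (nat \<Rightarrow> real) measure" where
  "weighted q \<mu> = density \<mu> (\<lambda>z. ennreal (peval q z))"

definition marginal :: "nat set \<Rightarrow> (nat \<Rightarrow> real) measure \<Rightarrow> (nat \<Rightarrow> real) measure" where
  "marginal L \<nu> = distr \<nu> (Pi\<^sub>M L (\<lambda>_. borel)) (\<lambda>z. restrict z L)"

text \<open>Feasible families \<open>(\<mu>\<^sub>1, \<dots>, \<mu>\<^sub>N)\<close>; \<open>KK i\<close> is the set carrying \<open>\<mu>\<^sub>i\<close>.\<close>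

definition feasible ::
    "nat \<Rightarrow> (nat \<Rightarrow> nat set) \<Rightarrow> (nat \<Rightarrow> (nat \<Rightarrow> real) set) \<Rightarrow> (nat \<Rightarrow> rpoly) \<Rightarrow>
     (nat \<Rightarrow> (nat \<Rightarrow> real) measure) set" where
  "feasible N I KK q = {\<mu>.
     (\<forall>i\<in>{1..N}. \<mu> i \<in> borel_measures (I i) (KK i)) \<and>
     (\<forall>i\<in>{1..N}. (\<integral>z. peval (q i) z \<partial>\<mu> i) = 1) \<and>
     (\<forall>i\<in>{1..N - 1}. \<forall>j\<in>later_neighbours N I i.
        marginal (I i \<inter> I j) (weighted (q i) (\<mu> i)) =
        marginal (I i \<inter> I j) (weighted (q j) (\<mu> j)))}"

text \<open>Both optimal values are taken in \<^typ>\<open>ereal\<close>, so that the infimum over an empty set is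
  \<open>\<infinity>\<close>.\<close>

definition f_star ::
    "nat \<Rightarrow> (nat \<Rightarrow> real) set \<Rightarrow> (nat \<Rightarrow> rpoly) \<Rightarrow> (nat \<Rightarrow> rpoly) \<Rightarrow> ereal" where
  "f_star N K p q = (INF x\<in>K. ereal (\<Sum>i=1..N. peval (p i) x / peval (q i) x))"

definition f_hat ::
    "nat \<Rightarrow> (nat \<Rightarrow> nat set) \<Rightarrow> (nat \<Rightarrow> (nat \<Rightarrow> real) set) \<Rightarrow> (nat \<Rightarrow> rpoly) \<Rightarrow>
     (nat \<Rightarrow> rpoly) \<Rightarrow> ereal" where
  "f_hat N I KK p q =
     (INF \<mu>\<in>feasible N I KK q. ereal (\<Sum>i=1..N. \<integral>z. peval (p i) z \<partial>\<mu> i))"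

end

theory Submission
  imports Defs "HOL-Probability.Giry_Monad"
begin

text \<open>
  For \<open>f_hat \<le> f_star\<close>, a point \<open>x\<close> of \<open>K\<close> yields the feasible family of the Dirac measures at the
  restrictions of \<open>x\<close> to the cliques \<open>I i\<close>, divided by the values of the denominators \<open>q i\<close>; its
  objective value is the value of the sum of ratios at \<open>x\<close>.

  For \<open>f_star \<le> f_hat\<close>, put \<open>\<nu> i = q i d\<mu> i\<close>. These are probability measures whose marginals on the
  pairwise intersections of cliques agree, and the objective is the sum of the integrals of
  \<open>p i / q i\<close> against \<open>\<nu> i\<close>. One could glue the \<open>\<nu> i\<close> to a probability measure on \<open>K\<close> by
  disintegration. Instead, the proof dualises the gluing into dynamic programming: the running
  intersection property makes the cliques a tree, and its leaves are eliminated one by one. If the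
  leaf \<open>I n\<close> meets the rest of the tree in \<open>S \<subseteq> I j\<close>, the function on the leaf is replaced by its
  partial minimum over the variables outside \<open>S\<close>, and this function of the variables in \<open>S\<close>, whose
  integral can equally be computed from \<open>\<nu> j\<close>, is added to the function on \<open>I j\<close>. At the root, a
  probability measure integrates a function that is bounded below by the infimum of the whole sum
  (lemma \<open>tree_structured_lower_bound\<close>).

  Partial minimisation needs functions that remain measurable. This holds for functions to
  \<open>[0, \<infinity>]\<close> with compact sublevel sets (lemmas \<open>inf_compact_fibre_inf\<close> and
  \<open>inf_compact_add_comp\<close>): the ratio \<open>p i / q i\<close>, shifted by a constant to become nonnegative and
  set to \<open>\<infinity>\<close> off a compact set that carries \<open>\<nu> i\<close>, is of this kind. That set is the part of
  \<open>KK i\<close> in the ball of squared radius \<open>M\<close>.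
\<close>

section \<open>Functions with compact sublevel sets\<close>

text \<open>
  Lower semicontinuity together with compactness of the sublevel sets at finite levels, the class of
  functions that survives both operations of the elimination below: adding, and taking infima along
  fibres. The value \<open>\<infinity>\<close> encodes membership constraints.
\<close>

definition inf_compact :: "('a::topological_space \<Rightarrow> ennreal) \<Rightarrow> bool" where
  "inf_compact h \<longleftrightarrow> (\<forall>t<\<infinity>. compact {z. h z \<le> t})"

lemma inf_compact_closed_sublevel:
  fixes h :: "'a::t2_space \<Rightarrow> ennreal"
  assumes "inf_compact h"
  shows "closed {z. h z \<le> t}"
proof (cases "t = \<infinity>")
  case False
  then show ?thesis
    using assms by (simp add: inf_compact_def compact_imp_closed less_top)
qed simp

lemma inf_compact_borel_measurable:
  fixes h :: "'a::t2_space \<Rightarrow> ennreal"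
  assumes "inf_compact h"
  shows "h \<in> borel_measurable borel"
  by (rule borel_measurableI_le)
     (use borel_closed[OF inf_compact_closed_sublevel[OF assms]] in simp)

text \<open>
  A sum \<open>u + v\<close> is at most \<open>t\<close> iff \<open>u\<close> and \<open>v\<close> are, and no pair of levels \<open>a < u\<close>, \<open>b < v\<close> has
  \<open>a + b > t\<close>. So the sublevel set of the sum is cut out of one of \<open>h\<close> by closed sets.
\<close>

lemma inf_compact_add_comp:
  fixes h :: "'a::t2_space \<Rightarrow> ennreal" and \<phi> :: "'b::t2_space \<Rightarrow> ennreal"
  assumes h: "inf_compact h" and \<phi>: "inf_compact \<phi>" and r: "continuous_on UNIV r"
  shows "inf_compact (\<lambda>z. h z + \<phi> (r z))"
  unfolding inf_compact_def
proof (intro allI impI)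
  fix t :: ennreal
  assume t: "t < \<infinity>"
  define P where "P = {(a, b). t < a + b}"
  have cl: "closed {z. \<phi> (r z) \<le> b}" for b
    using closed_vimage[OF inf_compact_closed_sublevel[OF \<phi>, of b] r] by (simp add: vimage_def)
  have "{z. h z + \<phi> (r z) \<le> t} =
      {z. h z \<le> t} \<inter> ({z. \<phi> (r z) \<le> t} \<inter> (\<Inter>(a, b)\<in>P. {z. h z \<le> a} \<union> {z. \<phi> (r z) \<le> b}))"
    (is "?L = ?R")
  proof (intro equalityI subsetI)
    fix z
    assume "z \<in> ?L"
    then have le: "h z + \<phi> (r z) \<le> t"
      by simp
    have "h z \<le> t" "\<phi> (r z) \<le> t"
      using order_trans[OF _ le, of "h z"] order_trans[OF _ le, of "\<phi> (r z)"]
      by (simp_all add: add_increasing add_increasing2)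
    moreover have "h z \<le> a \<or> \<phi> (r z) \<le> b" if "t < a + b" for a b
    proof (rule ccontr)
      assume "\<not> (h z \<le> a \<or> \<phi> (r z) \<le> b)"
      then have "a + b \<le> h z + \<phi> (r z)"
        by (intro add_mono) auto
      then show False
        using le that by auto
    qed
    ultimately show "z \<in> ?R"
      by (auto simp: P_def)
  next
    fix z
    assume z: "z \<in> ?R"
    show "z \<in> ?L"
    proof (rule ccontr)
      assume "z \<notin> ?L"
      then have gt: "t < h z + \<phi> (r z)"
        by auto
      have fin: "h z \<le> t" "\<phi> (r z) \<le> t"
        using z by auto
      obtain u v w where uvw: "h z = ennreal u" "\<phi> (r z) = ennreal v" "t = ennreal w"
        "0 \<le> u" "0 \<le> v" "0 \<le> w"
        using fin t by (metis ennreal_cases infinity_ennreal_def leD less_top)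
      have uv: "w < u + v" "u \<le> w" "v \<le> w"
        using gt fin uvw by (simp_all add: ennreal_less_iff flip: ennreal_plus)
      \<comment> \<open>Lowering both summands by at most a third of the excess over \<open>t\<close> keeps their sum above \<open>t\<close>; the
        inner minimum keeps the lowered values nonnegative, as truncation at \<open>0\<close> would spoil this.\<close>
      define e where "e = min (min u v) (u + v - w) / 3"
      have e: "0 < e" "e \<le> u" "e \<le> v" "w < (u - e) + (v - e)"
      proof -
        have "3 * e \<le> u" "3 * e \<le> v" "3 * e \<le> u + v - w"
          by (simp_all add: e_def)
        moreover have "0 < e"
          using uv by (simp add: e_def)
        ultimately show "0 < e" "e \<le> u" "e \<le> v" "w < (u - e) + (v - e)"
          using uv by linarith+
      qed
      have "(ennreal (u - e), ennreal (v - e)) \<in> P"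
        using e uvw by (simp add: P_def ennreal_less_iff flip: ennreal_plus)
      then have "h z \<le> ennreal (u - e) \<or> \<phi> (r z) \<le> ennreal (v - e)"
        using z by auto
      then show False
        using uvw e by auto
    qed
  qed
  moreover have "compact {z. h z \<le> t}"
    using h t by (simp add: inf_compact_def)
  moreover have "closed (\<Inter>(a, b)\<in>P. {z. h z \<le> a} \<union> {z. \<phi> (r z) \<le> b})"
    using cl inf_compact_closed_sublevel[OF h] by (auto intro!: closed_INT closed_Un)
  ultimately show "compact {z. h z + \<phi> (r z) \<le> t}"
    using cl by (simp add: compact_Int_closed closed_Int)
qed

text \<open>
  The infimum over a fibre is at most \<open>t\<close> iff for every \<open>s > t\<close> the fibre meets \<open>{h \<le> s}\<close>. Hence the
  sublevel set is an intersection of continuous images of compact sets.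
\<close>

lemma inf_compact_fibre_inf:
  fixes h :: "'a::t2_space \<Rightarrow> ennreal" and r :: "'a \<Rightarrow> 'b::t2_space"
  assumes h: "inf_compact h" and r: "continuous_on UNIV r"
  shows "inf_compact (\<lambda>y. INF z\<in>{z. r z = y}. h z)"
  unfolding inf_compact_def
proof (intro allI impI)
  fix t :: ennreal
  assume t: "t < \<infinity>"
  have comp: "compact (r ` {z. h z \<le> s})" if "s < \<infinity>" for s
    using h r that unfolding inf_compact_def
    by (intro compact_continuous_image) (auto intro: continuous_on_subset)
  have "{y. (INF z\<in>{z. r z = y}. h z) \<le> t} = (\<Inter>s\<in>{t<..<\<infinity>}. r ` {z. h z \<le> s})"
  proof (intro equalityI subsetI)
    fix y
    assume y: "y \<in> {y. (INF z\<in>{z. r z = y}. h z) \<le> t}"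
    show "y \<in> (\<Inter>s\<in>{t<..<\<infinity>}. r ` {z. h z \<le> s})"
    proof
      fix s
      assume "s \<in> {t<..<\<infinity>}"
      then have "(INF z\<in>{z. r z = y}. h z) < s"
        using y by auto
      then show "y \<in> r ` {z. h z \<le> s}"
        by (auto simp: INF_less_iff less_imp_le)
    qed
  next
    fix y
    assume y: "y \<in> (\<Inter>s\<in>{t<..<\<infinity>}. r ` {z. h z \<le> s})"
    have "(INF z\<in>{z. r z = y}. h z) \<le> t"
    proof (rule dense_ge)
      fix s
      assume s: "t < s"
      show "(INF z\<in>{z. r z = y}. h z) \<le> s"
      proof (cases "s = \<infinity>")
        case False
        then have "s \<in> {t<..<\<infinity>}"
          using s by (simp add: less_top)
        then obtain z where "r z = y" "h z \<le> s"
          using y by blast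
        then show ?thesis
          by (auto intro: INF_lower2)
      qed simp
    qed
    then show "y \<in> {y. (INF z\<in>{z. r z = y}. h z) \<le> t}"
      by simp
  qed
  moreover have "compact (\<Inter>s\<in>{t<..<\<infinity>}. r ` {z. h z \<le> s})"
  proof -
    obtain s where s: "s \<in> {t<..<\<infinity>}"
      using dense[OF t] by (metis greaterThanLessThan_iff)
    have "closed (\<Inter>s\<in>{t<..<\<infinity>}. r ` {z. h z \<le> s})"
      using comp by (intro closed_INT ballI compact_imp_closed) auto
    moreover have "compact (r ` {z. h z \<le> s})"
      using s comp by auto
    moreover have eq: "(\<Inter>s\<in>{t<..<\<infinity>}. r ` {z. h z \<le> s}) =
        r ` {z. h z \<le> s} \<inter> (\<Inter>s\<in>{t<..<\<infinity>}. r ` {z. h z \<le> s})"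
      using s by auto
    ultimately show ?thesis
      by (subst eq) (intro compact_Int_closed)
  qed
  ultimately show "compact {y. (INF z\<in>{z. r z = y}. h z) \<le> t}"
    by simp
qed

section \<open>Eliminating cliques along a running intersection\<close>

lemma continuous_on_restrict_coordinates:
  "continuous_on UNIV (\<lambda>z::nat \<Rightarrow> real. restrict z L)"
proof (rule continuous_on_coordinatewise_then_product)
  show "continuous_on UNIV (\<lambda>z. restrict z L i)" for i
    by (cases "i \<in> L") auto
qed

text \<open>
  Induction on the number of cliques, eliminating the last one, \<open>I n\<close>. By the running intersection
  property the variables \<open>S\<close> that it shares with the earlier cliques all lie in a single \<open>I j\<close>. Let
  \<open>\<phi> y\<close> be the infimum of \<open>h n\<close> over the points that restrict to \<open>y\<close> on \<open>S\<close>. Then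
  \<open>\<phi> \<circ> restrict \<le> h n\<close>, and as \<open>\<nu> n\<close> and \<open>\<nu> j\<close> have the same marginal on \<open>S\<close>, the integral of
  \<open>h n\<close> is at least that of \<open>\<phi> \<circ> restrict\<close> against \<open>\<nu> j\<close>. Adding \<open>\<phi> \<circ> restrict\<close> to \<open>h j\<close>
  therefore does not increase the sum of integrals, and the pointwise bound by \<open>c\<close> is inherited
  because points of \<open>I n\<close> agreeing with \<open>x\<close> on \<open>S\<close> can be glued to \<open>x\<close>.
\<close>

lemma tree_structured_lower_bound:
  fixes I :: "nat \<Rightarrow> nat set" and h :: "nat \<Rightarrow> (nat \<Rightarrow> real) \<Rightarrow> ennreal"
    and \<nu> :: "nat \<Rightarrow> (nat \<Rightarrow> real) measure"
  assumes "1 \<le> N" and "running_intersection N I"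
    and "\<And>i. i \<in> {1..N} \<Longrightarrow> prob_space (\<nu> i)"
    and "\<And>i. i \<in> {1..N} \<Longrightarrow> sets (\<nu> i) = sets borel"
    and "\<And>i j. 1 \<le> i \<Longrightarrow> i < j \<Longrightarrow> j \<le> N \<Longrightarrow>
      distr (\<nu> i) borel (\<lambda>z. restrict z (I i \<inter> I j)) =
      distr (\<nu> j) borel (\<lambda>z. restrict z (I i \<inter> I j))"
    and "\<And>i. i \<in> {1..N} \<Longrightarrow> inf_compact (h i)"
    and "\<And>i z. i \<in> {1..N} \<Longrightarrow> h i z < \<infinity> \<Longrightarrow> z \<in> extensional (I i)"
    and "c < \<infinity>"
    and "\<And>x. c \<le> (\<Sum>i=1..N. h i (restrict x (I i)))"
  shows "c \<le> (\<Sum>i=1..N. \<integral>\<^sup>+z. h i z \<partial>\<nu> i)"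
  using assms
proof (induction N arbitrary: h rule: nat_induct_at_least)
  case base
  interpret prob_space "\<nu> 1"
    using base.prems(2) by simp
  have "c \<le> h 1 z" for z
  proof (cases "h 1 z = \<infinity>")
    case False
    then have "restrict z (I 1) = z"
      using base.prems(6)[of 1 z] by (simp add: extensional_restrict less_top)
    then show ?thesis
      using base.prems(8)[of z] by simp
  qed simp
  then have "(\<integral>\<^sup>+z. c \<partial>\<nu> 1) \<le> (\<integral>\<^sup>+z. h 1 z \<partial>\<nu> 1)"
    by (intro nn_integral_mono)
  then show ?case
    by (simp add: emeasure_space_1 del: One_nat_def)
next
  case (Suc N)
  define n where "n = Suc N"
  define S where "S = I n \<inter> (\<Union>k\<in>{1..N}. I k)"
  obtain j where j: "j \<in> {1..N}" "S \<subseteq> I j"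
  proof -
    have "n \<in> {2..Suc N}" "{1..n - 1} = {1..N}"
      using Suc.hyps by (auto simp: n_def)
    then show thesis
      using Suc.prems(1) that unfolding running_intersection_def S_def by metis
  qed
  have S_eq: "S = I j \<inter> I n"
    using j unfolding S_def by auto
  define \<phi> where "\<phi> = (\<lambda>y. INF z\<in>{z. restrict z S = y}. h n z)"
  define h' where "h' = h(j := \<lambda>z. h j z + \<phi> (restrict z S))"
  have hn: "inf_compact (h n)"
    using Suc.prems(5) unfolding n_def by simp
  have \<phi>: "inf_compact \<phi>"
    unfolding \<phi>_def by (rule inf_compact_fibre_inf[OF hn continuous_on_restrict_coordinates])
  have \<phi>_le: "\<phi> (restrict z S) \<le> h n z" for z
    unfolding \<phi>_def by (rule INF_lower) simp
  note [measurable] = inf_compact_borel_measurable[OF \<phi>] 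
    borel_measurable_continuous_onI[OF continuous_on_restrict_coordinates]
  have "c \<le> (\<Sum>i=1..N. \<integral>\<^sup>+z. h' i z \<partial>\<nu> i)"
  proof (rule Suc.IH)
    show "running_intersection N I"
      using Suc.prems(1) by (auto simp: running_intersection_def)
    show "inf_compact (h' i)" if "i \<in> {1..N}" for i
      using that Suc.prems(5) inf_compact_add_comp[OF _ \<phi> continuous_on_restrict_coordinates] j
      by (auto simp: h'_def)
    show "z \<in> extensional (I i)" if "i \<in> {1..N}" "h' i z < \<infinity>" for i z
      using that Suc.prems(6)[of i z] by (auto simp: h'_def split: if_splits)
    fix x :: "nat \<Rightarrow> real"
    define a where "a = (\<Sum>i=1..N. h i (restrict x (I i)))"
    \<comment> \<open>Moving \<open>a\<close> to the left-hand side lets the infimum be bounded member by member.\<close>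
    have "c - a \<le> \<phi> (restrict x S)"
      unfolding \<phi>_def
    proof (rule INF_greatest)
      fix z
      assume "z \<in> {z. restrict z S = restrict x S}"
      then have eq: "restrict z S = restrict x S"
        by simp
      have zx: "z k = x k" if "k \<in> S" for k
        using fun_cong[OF eq, of k] that by simp
      show "c - a \<le> h n z"
      proof (cases "h n z = \<infinity>")
        case False
        then have ext: "z \<in> extensional (I n)"
          using Suc.prems(6)[of n z] by (simp add: n_def less_top)
        \<comment> \<open>The glued point: \<open>z\<close> on the eliminated clique, \<open>x\<close> elsewhere.\<close>
        define y where "y k = (if k \<in> I n then z k else x k)" for k
        have "restrict y (I n) = z"
          using ext by (auto simp: y_def fun_eq_iff extensional_def)
        moreover have "restrict y (I i) = restrict x (I i)" if "i \<in> {1..N}" for i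
        proof
          fix k
          show "restrict y (I i) k = restrict x (I i) k"
          proof (cases "k \<in> I i \<inter> I n")
            case True
            then have "k \<in> S"
              using that by (auto simp: S_def)
            then show ?thesis
              using True by (simp add: y_def zx)
          qed (auto simp: y_def)
        qed
        ultimately have "(\<Sum>i=1..N. h i (restrict y (I i))) + h n (restrict y (I n)) = a + h n z"
          unfolding a_def by (intro arg_cong2[where f = "(+)"] sum.cong refl) simp_all
        moreover have "(\<Sum>i=1..Suc N. h i (restrict y (I i))) =
            (\<Sum>i=1..N. h i (restrict y (I i))) + h n (restrict y (I n))"
          unfolding n_def by (subst add.commute) (rule sum.nat_ivl_Suc', simp)
        ultimately have "c \<le> a + h n z"
          using Suc.prems(8)[of y] by (simp only:)
        then show ?thesis
          using \<open>c < \<infinity>\<close> by (auto simp: ennreal_minus_le_iff)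
      qed simp
    qed
    then have "c \<le> a + \<phi> (restrict x S)"
      using \<open>c < \<infinity>\<close> by (auto simp: ennreal_minus_le_iff)
    also have "\<dots> = (\<Sum>i=1..N. h i (restrict x (I i)) + (if i = j then \<phi> (restrict x S) else 0))"
      using j by (simp add: a_def sum.distrib)
    also have "\<dots> = (\<Sum>i=1..N. h' i (restrict x (I i)))"
      using j(2) by (intro sum.cong) (auto simp: h'_def Int_absorb1)
    finally show "c \<le> (\<Sum>i=1..N. h' i (restrict x (I i)))" .
    show "distr (\<nu> i) borel (\<lambda>z. restrict z (I i \<inter> I k)) =
        distr (\<nu> k) borel (\<lambda>z. restrict z (I i \<inter> I k))" if "1 \<le> i" "i < k" "k \<le> N" for i k
      by (rule Suc.prems(4)) (use that in auto)
  qed (use Suc.prems(2,3,7) in auto)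
  also have "\<dots> = (\<Sum>i=1..N. (\<integral>\<^sup>+z. h i z \<partial>\<nu> i) +
      (if i = j then \<integral>\<^sup>+z. \<phi> (restrict z S) \<partial>\<nu> j else 0))"
  proof (intro sum.cong refl)
    fix i
    assume i: "i \<in> {1..N}"
    have "measurable (\<nu> i) borel = measurable borel (borel :: ennreal measure)"
      using Suc.prems(3)[of i] i by (intro measurable_cong_sets) auto
    moreover have "h i \<in> borel_measurable borel"
      using Suc.prems(5) i by (intro inf_compact_borel_measurable) auto
    moreover have "(\<lambda>z. \<phi> (restrict z S)) \<in> borel_measurable borel"
      by measurable
    ultimately have "h i \<in> borel_measurable (\<nu> i)"
      "(\<lambda>z. \<phi> (restrict z S)) \<in> borel_measurable (\<nu> i)"
      by simp_all
    then show "(\<integral>\<^sup>+z. h' i z \<partial>\<nu> i) = (\<integral>\<^sup>+z. h i z \<partial>\<nu> i) +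
        (if i = j then \<integral>\<^sup>+z. \<phi> (restrict z S) \<partial>\<nu> j else 0)"
      by (cases "i = j") (simp_all add: h'_def nn_integral_add del: restrict_apply)
  qed
  also have "\<dots> = (\<Sum>i=1..N. \<integral>\<^sup>+z. h i z \<partial>\<nu> i) + (\<integral>\<^sup>+z. \<phi> (restrict z S) \<partial>\<nu> j)"
    using j by (simp add: sum.distrib)
  also have "(\<integral>\<^sup>+z. \<phi> (restrict z S) \<partial>\<nu> j) = (\<integral>\<^sup>+z. \<phi> (restrict z S) \<partial>\<nu> n)"
  proof -
    have meas: "(\<lambda>z. restrict z S) \<in> measurable (\<nu> i) borel" if "i \<in> {1..n}" for i
      using Suc.prems(3)[of i] that measurable_cong_sets[of "\<nu> i" borel borel borel]
      by (simp add: n_def)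
    have distr: "(\<integral>\<^sup>+y. \<phi> y \<partial>distr (\<nu> i) borel (\<lambda>z. restrict z S)) =
        (\<integral>\<^sup>+z. \<phi> (restrict z S) \<partial>\<nu> i)" if "i \<in> {1..n}" for i
      by (rule nn_integral_distr[OF meas[OF that]]) measurable
    have "distr (\<nu> j) borel (\<lambda>z. restrict z S) = distr (\<nu> n) borel (\<lambda>z. restrict z S)"
      unfolding S_eq by (rule Suc.prems(4)) (use j in \<open>auto simp: n_def\<close>)
    moreover have "j \<in> {1..n}" "n \<in> {1..n}"
      using j by (auto simp: n_def)
    ultimately show ?thesis
      using distr by metis
  qed
  also have "(\<integral>\<^sup>+z. \<phi> (restrict z S) \<partial>\<nu> n) \<le> (\<integral>\<^sup>+z. h n z \<partial>\<nu> n)"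
    by (intro nn_integral_mono \<phi>_le)
  finally show ?case
    by (simp add: n_def add_left_mono)
qed

lemma inf_compact_extend_by_top:
  fixes f :: "'a::t2_space \<Rightarrow> real"
  assumes A: "compact A" and f: "continuous_on A f" and nonneg: "\<And>z. z \<in> A \<Longrightarrow> 0 \<le> f z"
  shows "inf_compact (\<lambda>z. if z \<in> A then ennreal (f z) else \<infinity>)"
  unfolding inf_compact_def
proof (intro allI impI)
  fix t :: ennreal
  assume "t < \<infinity>"
  then obtain w where w: "t = ennreal w" "0 \<le> w"
    by (cases t) auto
  have "{z. (if z \<in> A then ennreal (f z) else \<infinity>) \<le> t} = A \<inter> (A \<inter> f -` {..w})"
    using w by (auto split: if_splits simp: ennreal_le_iff top_unique)
  moreover have "closed (A \<inter> f -` {..w})"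
    by (rule continuous_closed_preimage[OF f compact_imp_closed[OF A] closed_atMost])
  ultimately show "compact {z. (if z \<in> A then ennreal (f z) else \<infinity>) \<le> t}"
    using compact_Int_closed[OF A] by (simp only:)
qed

text \<open>
  The real-valued form of the preceding bound. On the compact sets \<open>A i\<close> the functions \<open>f i\<close> are
  bounded, so a constant \<open>b i\<close> makes them nonnegative; outside \<open>A i\<close> they are set to \<open>\<infinity>\<close>. The
  constants cancel since the \<open>\<nu> i\<close> are probability measures.
\<close>

lemma sum_integrals_lower_bound:
  fixes I :: "nat \<Rightarrow> nat set" and f :: "nat \<Rightarrow> (nat \<Rightarrow> real) \<Rightarrow> real"
    and \<nu> :: "nat \<Rightarrow> (nat \<Rightarrow> real) measure"
  assumes rip: "running_intersection N I"
    and prob: "\<And>i. i \<in> {1..N} \<Longrightarrow> prob_space (\<nu> i)"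
    and sets: "\<And>i. i \<in> {1..N} \<Longrightarrow> sets (\<nu> i) = sets borel"
    and marg: "\<And>i j. 1 \<le> i \<Longrightarrow> i < j \<Longrightarrow> j \<le> N \<Longrightarrow>
      distr (\<nu> i) borel (\<lambda>z. restrict z (I i \<inter> I j)) =
      distr (\<nu> j) borel (\<lambda>z. restrict z (I i \<inter> I j))"
    and A: "\<And>i. i \<in> {1..N} \<Longrightarrow> compact (A i)"
    and A_ext: "\<And>i. i \<in> {1..N} \<Longrightarrow> A i \<subseteq> extensional (I i)"
    and AE_A: "\<And>i. i \<in> {1..N} \<Longrightarrow> AE z in \<nu> i. z \<in> A i"
    and f_cont: "\<And>i. i \<in> {1..N} \<Longrightarrow> continuous_on (A i) (f i)"
    and f_meas: "\<And>i. i \<in> {1..N} \<Longrightarrow> f i \<in> borel_measurable borel"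
    and c_le: "\<And>x. (\<And>i. i \<in> {1..N} \<Longrightarrow> restrict x (I i) \<in> A i) \<Longrightarrow>
      c \<le> (\<Sum>i=1..N. f i (restrict x (I i)))"
  shows "c \<le> (\<Sum>i=1..N. \<integral>z. f i z \<partial>\<nu> i)"
proof (cases "N = 0")
  case True
  then show ?thesis
    using c_le by simp
next
  case False
  then have N: "1 \<le> N"
    by simp
  have "\<exists>b. \<forall>z\<in>A i. \<bar>f i z\<bar> \<le> b" if "i \<in> {1..N}" for i
    using compact_imp_bounded[OF compact_continuous_image[OF f_cont A], OF that that]
    by (auto simp: bounded_iff)
  then obtain b where b: "\<And>i z. i \<in> {1..N} \<Longrightarrow> z \<in> A i \<Longrightarrow> \<bar>f i z\<bar> \<le> b i"
    by metis
  define h where "h i z = (if z \<in> A i then ennreal (f i z + b i) else \<infinity>)" for i z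
  have int: "integrable (\<nu> i) (f i)" if i: "i \<in> {1..N}" for i
  proof -
    interpret prob_space "\<nu> i"
      by (rule prob[OF i])
    have [measurable]: "f i \<in> borel_measurable (\<nu> i)"
      using f_meas[OF i] sets[OF i] measurable_cong_sets by blast
    show ?thesis
      using AE_A[OF i] b[OF i] by (intro integrable_const_bound[of _ "b i"]) auto
  qed
  have AE_nonneg: "AE z in \<nu> i. 0 \<le> f i z + b i" if i: "i \<in> {1..N}" for i
    using AE_A[OF i]
  proof eventually_elim
    case (elim z)
    then show ?case
      using b[OF i elim] by linarith
  qed
  have integral_shift: "(\<integral>z. f i z + b i \<partial>\<nu> i) = (\<integral>z. f i z \<partial>\<nu> i) + b i" if i: "i \<in> {1..N}" for i
  proof -
    interpret prob_space "\<nu> i"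
      by (rule prob[OF i])
    show ?thesis
      using int[OF i] by (simp add: prob_space)
  qed
  have nonneg: "0 \<le> (\<integral>z. f i z \<partial>\<nu> i) + b i" if i: "i \<in> {1..N}" for i
    using integral_nonneg_AE[OF AE_nonneg[OF i]] integral_shift[OF i] by simp
  have "ennreal (c + (\<Sum>i=1..N. b i)) \<le> (\<Sum>i=1..N. \<integral>\<^sup>+z. h i z \<partial>\<nu> i)"
  proof (rule tree_structured_lower_bound[OF N rip prob sets marg])
    fix i
    assume i: "i \<in> {1..N}"
    have "0 \<le> f i z + b i" if "z \<in> A i" for z
      using b[OF i that] by linarith
    then show "inf_compact (h i)"
      unfolding h_def using A[OF i] f_cont[OF i]
      by (intro inf_compact_extend_by_top continuous_intros) auto
    show "z \<in> extensional (I i)" if "h i z < \<infinity>" for z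
      using that A_ext[OF i] by (auto simp: h_def split: if_splits)
  next
    fix x :: "nat \<Rightarrow> real"
    show "ennreal (c + (\<Sum>i=1..N. b i)) \<le> (\<Sum>i=1..N. h i (restrict x (I i)))"
    proof (cases "\<forall>i\<in>{1..N}. restrict x (I i) \<in> A i")
      case True
      then have "c + (\<Sum>i=1..N. b i) \<le> (\<Sum>i=1..N. f i (restrict x (I i)) + b i)"
        using c_le[of x] by (simp add: sum.distrib)
      then have "ennreal (c + (\<Sum>i=1..N. b i)) \<le> ennreal (\<Sum>i=1..N. f i (restrict x (I i)) + b i)"
        by (rule ennreal_leI)
      also have "\<dots> = (\<Sum>i=1..N. ennreal (f i (restrict x (I i)) + b i))"
      proof (rule sum_ennreal[symmetric])
        show "0 \<le> f i (restrict x (I i)) + b i" if "i \<in> {1..N}" for i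
          using b[OF that, of "restrict x (I i)"] True that by fastforce
      qed
      also have "\<dots> = (\<Sum>i=1..N. h i (restrict x (I i)))"
        using True by (intro sum.cong) (auto simp: h_def)
      finally show ?thesis .
    next
      case False
      then obtain i where i: "i \<in> {1..N}" "h i (restrict x (I i)) = \<infinity>"
        by (auto simp: h_def)
      have "ennreal (c + (\<Sum>i=1..N. b i)) \<le> h i (restrict x (I i))"
        by (simp add: i(2))
      also have "\<dots> \<le> (\<Sum>i=1..N. h i (restrict x (I i)))"
        using i(1) by (intro member_le_sum) auto
      finally show ?thesis .
    qed
  qed auto
  also have "\<dots> = (\<Sum>i=1..N. ennreal ((\<integral>z. f i z \<partial>\<nu> i) + b i))"
  proof (intro sum.cong refl)
    fix i
    assume i: "i \<in> {1..N}"
    interpret prob_space "\<nu> i"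
      by (rule prob[OF i])
    have "(\<integral>\<^sup>+z. h i z \<partial>\<nu> i) = (\<integral>\<^sup>+z. ennreal (f i z + b i) \<partial>\<nu> i)"
      using AE_A[OF i] by (intro nn_integral_cong_AE) (auto simp: h_def)
    also have "\<dots> = ennreal (\<integral>z. f i z + b i \<partial>\<nu> i)"
      using int[OF i] AE_nonneg[OF i] by (intro nn_integral_eq_integral) simp_all
    finally show "(\<integral>\<^sup>+z. h i z \<partial>\<nu> i) = ennreal ((\<integral>z. f i z \<partial>\<nu> i) + b i)"
      by (simp only: integral_shift[OF i])
  qed
  also have "\<dots> = ennreal (\<Sum>i=1..N. (\<integral>z. f i z \<partial>\<nu> i) + b i)"
    by (intro sum_ennreal nonneg)
  finally have "ennreal (c + (\<Sum>i=1..N. b i)) \<le> ennreal (\<Sum>i=1..N. (\<integral>z. f i z \<partial>\<nu> i) + b i)" .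
  moreover have "0 \<le> (\<Sum>i=1..N. (\<integral>z. f i z \<partial>\<nu> i) + b i)"
    by (intro sum_nonneg nonneg)
  ultimately have "c + (\<Sum>i=1..N. b i) \<le> (\<Sum>i=1..N. (\<integral>z. f i z \<partial>\<nu> i) + b i)"
    by (simp only: ennreal_le_iff)
  then show ?thesis
    by (simp add: sum.distrib)
qed

section \<open>Evaluation of polynomials\<close>

lemma peval_cong:
  assumes "p \<in> poly_ring L" and "\<And>k. k \<in> L \<Longrightarrow> x k = y k"
  shows "peval p x = peval p y"
  unfolding peval_def
proof (intro sum.cong refl arg_cong2[where f = "(*)"] prod.cong)
  fix a k
  assume "a \<in> Poly_Mapping.keys p" "k \<in> Poly_Mapping.keys a"
  then have "k \<in> L"
    using assms(1) by (auto simp: poly_ring_def)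
  then show "x k ^ Poly_Mapping.lookup a k = y k ^ Poly_Mapping.lookup a k"
    by (simp add: assms(2))
qed

lemma peval_restrict:
  assumes "p \<in> poly_ring L" and "L \<subseteq> L'"
  shows "peval p (restrict x L') = peval p x"
  using assms by (intro peval_cong[OF assms(1)]) auto

lemma continuous_on_peval: "continuous_on S (peval p)"
proof -
  have "continuous_on UNIV (peval p)"
    unfolding peval_def[abs_def] by (intro continuous_intros continuous_on_product_coordinates)
  then show ?thesis
    by (rule continuous_on_subset) simp
qed

lemma peval_borel_measurable [measurable]: "peval p \<in> borel_measurable borel"
  by (intro borel_measurable_continuous_onI continuous_on_peval)

lemma peval_superset:
  assumes "finite S" and "Poly_Mapping.keys p \<subseteq> S"
  shows "peval p x = (\<Sum>a\<in>S. Poly_Mapping.lookup p a *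
      (\<Prod>k\<in>Poly_Mapping.keys a. x k ^ Poly_Mapping.lookup a k))"
  unfolding peval_def
  by (rule sum.mono_neutral_left[OF assms]) (simp add: Poly_Mapping.in_keys_iff)

lemma peval_diff: "peval (p - q) x = peval p x - peval q x"
proof -
  define S where "S = Poly_Mapping.keys p \<union> Poly_Mapping.keys q"
  have "finite S" "Poly_Mapping.keys p \<subseteq> S" "Poly_Mapping.keys q \<subseteq> S"
    "Poly_Mapping.keys (p - q) \<subseteq> S"
    by (auto simp: S_def Poly_Mapping.in_keys_iff lookup_minus)
  then show ?thesis
    by (simp add: peval_superset[of S] lookup_minus left_diff_distrib sum_subtractf)
qed

lemma peval_add: "peval (p + q) x = peval p x + peval q x"
proof -
  have "peval ((p + q) - q) x = peval (p + q) x - peval q x"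
    by (rule peval_diff)
  then show ?thesis
    by simp
qed

lemma peval_single:
  "peval (Poly_Mapping.single a c) x =
    c * (\<Prod>k\<in>Poly_Mapping.keys a. x k ^ Poly_Mapping.lookup a k)"
  by (simp add: peval_def)

lemma peval_sum: "peval (\<Sum>i\<in>S. p i) x = (\<Sum>i\<in>S. peval (p i) x)"
proof (induction S rule: infinite_finite_induct)
  case (insert i S)
  then show ?case
    by (simp add: peval_add)
qed (simp_all add: peval_def)

lemma peval_ball_poly: "peval (ball_poly M L) x = M - (\<Sum>k\<in>L. (x k)\<^sup>2)"
  by (simp add: ball_poly_def peval_diff peval_sum peval_single)

text \<open>
  The polynomial depends on each variable of \<open>L\<close>: it drops by \<open>1\<close> from the origin to a unit vector.
  For the relaxation this says that the ball constraint of a clique \<open>I i\<close> can be assigned only to a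
  clique that contains \<open>I i\<close>.
\<close>

lemma ball_poly_in_poly_ring_imp_subset:
  assumes "finite L" and "ball_poly M L \<in> poly_ring L'"
  shows "L \<subseteq> L'"
proof (rule ccontr)
  assume "\<not> L \<subseteq> L'"
  then obtain l where l: "l \<in> L" "l \<notin> L'"
    by blast
  define x where "x k = (if k = l then 1 else 0 :: real)" for k
  have "peval (ball_poly M L) x = peval (ball_poly M L) (\<lambda>_. 0)"
    using l by (intro peval_cong[OF assms(2)]) (auto simp: x_def)
  moreover have "(\<Sum>k\<in>L. (x k)\<^sup>2) = 1"
  proof -
    have "(\<Sum>k\<in>L. (x k)\<^sup>2) = (\<Sum>k\<in>L. if k = l then 1 else 0)"
      by (intro sum.cong) (auto simp: x_def)
    then show ?thesis
      using l assms(1) by simp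
  qed
  ultimately show False
    by (simp add: peval_ball_poly)
qed

section \<open>Closed and compact sets of extensional points\<close>

text \<open>
  Points of \<open>\<real>\<^sup>L\<close> take the fixed value \<^const>\<open>undefined\<close> off \<open>L\<close>, so \<open>\<real>\<^sup>L\<close> is a closed subset of the
  space of all functions \<open>nat \<Rightarrow> real\<close>. This one ambient space, with its product topology, hosts all
  cliques at once.
\<close>

lemma closed_extensional: "closed (extensional L :: (nat \<Rightarrow> real) set)"
proof -
  have "extensional L = (\<Inter>k\<in>- L. {z :: nat \<Rightarrow> real. z k = undefined})"
    by (auto simp: extensional_def)
  moreover have "closed {z :: nat \<Rightarrow> real. z k = undefined}" for k
    by (intro closed_Collect_eq continuous_intros continuous_on_product_coordinates)
  ultimately show ?thesis
    by auto
qed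

lemma closed_basic_set: "closed (basic_set L J g)"
proof -
  have "basic_set L J g = extensional L \<inter> (\<Inter>j\<in>J. {z. 0 \<le> peval (g j) z})"
    by (auto simp: basic_set_def PiE_def)
  moreover have "closed {z. 0 \<le> peval (g j) z}" for j
    by (intro closed_Collect_le continuous_intros continuous_on_peval)
  ultimately show ?thesis
    using closed_extensional by (auto intro!: closed_Int)
qed

lemma compact_extensional_ball:
  fixes L :: "nat set"
  assumes "finite L"
  shows "compact {z \<in> extensional L. (\<Sum>k\<in>L. (z k :: real)\<^sup>2) \<le> M}"
    (is "compact ?B")
proof -
  \<comment> \<open>By Tychonoff the ball lies in a compact box, whose side off \<open>L\<close> is a single point.\<close>
  define S where "S k = (if k \<in> L then {- sqrt M..sqrt M} else {undefined :: real})" for k :: nat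
  have "compactin (product_topology (\<lambda>_. euclidean) UNIV) (PiE UNIV S)"
    unfolding compactin_PiE by (auto simp: S_def compactin_euclidean_iff)
  then have box: "compact (PiE UNIV S)"
    by (simp add: euclidean_product_topology compactin_euclidean_iff)
  have "z k \<in> S k" if z: "z \<in> ?B" for z k
  proof (cases "k \<in> L")
    case True
    have "(z k)\<^sup>2 \<le> (\<Sum>k\<in>L. (z k)\<^sup>2)"
      using True assms by (intro member_le_sum) auto
    also have "\<dots> \<le> M"
      using z by simp
    finally have "\<bar>z k\<bar> \<le> sqrt M"
      using real_sqrt_le_mono by fastforce
    then show ?thesis
      using True by (auto simp: S_def)
  next
    case False
    then show ?thesis
      using z by (auto simp: S_def extensional_def)
  qed
  then have sub: "?B \<subseteq> PiE UNIV S"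
    by auto
  have "closed {z. (\<Sum>k\<in>L. (z k :: real)\<^sup>2) \<le> M}"
    by (intro closed_Collect_le continuous_intros continuous_on_product_coordinates)
  then have "closed ?B"
    using closed_Int[OF closed_extensional] by (simp add: Collect_conj_eq)
  then have "compact (PiE UNIV S \<inter> ?B)"
    using box by (rule compact_Int_closed[rotated])
  then show ?thesis
    using sub by (simp add: Int_absorb1)
qed

section \<open>Weighted measures in the common ambient space\<close>

lemma id_measurable_PiM_borel:
  "(\<lambda>z. z) \<in> Pi\<^sub>M L (\<lambda>_. borel :: real measure) \<rightarrow>\<^sub>M (borel :: (nat \<Rightarrow> real) measure)"
proof (rule measurable_coordinatewise_then_product)
  fix i
  show "(\<lambda>z. z i) \<in> borel_measurable (Pi\<^sub>M L (\<lambda>_. borel :: real measure))"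
  proof (cases "i \<in> L")
    case True
    then show ?thesis
      by (rule measurable_component_singleton)
  next
    case False
    then have "z i = undefined" if "z \<in> space (Pi\<^sub>M L (\<lambda>_. borel :: real measure))" for z
      using that by (auto simp: space_PiM PiE_def extensional_def)
    then show ?thesis
      by (subst measurable_cong[where g = "\<lambda>_. undefined"]) auto
  qed
qed

lemma space_restrict_PiM:
  assumes "A \<subseteq> extensional L"
  shows "space (restrict_space (Pi\<^sub>M L (\<lambda>_. borel :: real measure)) A) = A"
  using assms by (auto simp: space_restrict_space space_PiM PiE_def)

lemma measurable_restrict_PiM:
  assumes "f \<in> borel_measurable (borel :: (nat \<Rightarrow> real) measure)"
  shows "f \<in> borel_measurable (restrict_space (Pi\<^sub>M L (\<lambda>_. borel :: real measure)) A)"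
  by (rule measurable_compose[OF measurable_restrict_space1[OF id_measurable_PiM_borel] assms])

text \<open>
  Regarding measures on the various \<open>\<real>\<^sup>L\<close> as Borel measures on one space makes their marginals
  comparable by continuous restriction maps.
\<close>

definition ambient :: "(nat \<Rightarrow> real) measure \<Rightarrow> (nat \<Rightarrow> real) measure" where
  "ambient \<nu> = distr \<nu> borel (\<lambda>z. z)"

lemma sets_ambient [simp]: "sets (ambient \<nu>) = sets borel"
  by (simp add: ambient_def)

context
  fixes \<mu> :: "(nat \<Rightarrow> real) measure" and L :: "nat set" and A :: "(nat \<Rightarrow> real) set" and q :: rpoly
  assumes \<mu>: "\<mu> \<in> borel_measures L A"
    and A_ext: "A \<subseteq> extensional L"
begin

lemma space_borel_measures: "space \<mu> = A"
  using \<mu> sets_eq_imp_space_eq[of \<mu> "restrict_space (Pi\<^sub>M L (\<lambda>_. borel)) A"]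
  by (simp add: borel_measures_def space_restrict_PiM[OF A_ext])

lemma id_measurable_borel_measures: "(\<lambda>z. z) \<in> \<mu> \<rightarrow>\<^sub>M borel"
proof -
  have "measurable \<mu> (borel :: (nat \<Rightarrow> real) measure) =
      measurable (restrict_space (Pi\<^sub>M L (\<lambda>_. borel)) A) borel"
    using \<mu> by (intro measurable_cong_sets) (auto simp: borel_measures_def)
  then show ?thesis
    using measurable_restrict_space1[OF id_measurable_PiM_borel] by simp
qed

lemma id_measurable_weighted: "(\<lambda>z. z) \<in> weighted q \<mu> \<rightarrow>\<^sub>M borel"
  using id_measurable_borel_measures by (simp add: weighted_def)

lemma measurable_borel_measures: "f \<in> borel_measurable borel \<Longrightarrow> f \<in> borel_measurable \<mu>"
  by (rule measurable_compose[OF id_measurable_borel_measures])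

lemma AE_ambient_weighted:
  assumes "closed A"
  shows "AE z in ambient (weighted q \<mu>). z \<in> A"
proof -
  have "{z \<in> space borel. z \<in> A} \<in> sets borel"
    using borel_closed[OF assms] by simp
  moreover have "AE z in weighted q \<mu>. z \<in> A"
    by (rule AE_I2) (simp add: weighted_def space_borel_measures)
  ultimately show ?thesis
    unfolding ambient_def by (subst AE_distr_iff[OF id_measurable_weighted])
qed

lemma prob_space_ambient_weighted:
  assumes q_pos: "\<And>z. z \<in> A \<Longrightarrow> 0 < peval q z"
    and int: "(\<integral>z. peval q z \<partial>\<mu>) = 1"
  shows "prob_space (ambient (weighted q \<mu>))"
  unfolding ambient_def
proof (intro prob_space.prob_space_distr prob_spaceI id_measurable_weighted)
  have [measurable]: "peval q \<in> borel_measurable \<mu>"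
    by (intro measurable_borel_measures peval_borel_measurable)
  \<comment> \<open>The integral of a non-integrable function is \<open>0\<close> by convention, so the value \<open>1\<close> forces
    integrability.\<close>
  have "integrable \<mu> (peval q)"
    using int not_integrable_integral_eq[of \<mu> "peval q"] by auto
  then have "(\<integral>\<^sup>+z. ennreal (peval q z) \<partial>\<mu>) = 1"
    using int q_pos by (subst nn_integral_eq_integral) (auto simp: space_borel_measures less_imp_le)
  moreover have "emeasure (weighted q \<mu>) (space (weighted q \<mu>)) =
      (\<integral>\<^sup>+z. ennreal (peval q z) * indicator (space \<mu>) z \<partial>\<mu>)"
    by (simp add: weighted_def emeasure_density)
  moreover have "\<dots> = (\<integral>\<^sup>+z. ennreal (peval q z) \<partial>\<mu>)"
    by (intro nn_integral_cong) simp
  ultimately show "emeasure (weighted q \<mu>) (space (weighted q \<mu>)) = 1"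
    by simp
qed

text \<open>The denominator is restored by the density: \<open>(p / q) (q d\<mu>) = p d\<mu>\<close>.\<close>

lemma integral_ambient_weighted:
  assumes q_pos: "\<And>z. z \<in> A \<Longrightarrow> 0 < peval q z"
  shows "(\<integral>z. peval p z / peval q z \<partial>ambient (weighted q \<mu>)) = (\<integral>z. peval p z \<partial>\<mu>)"
proof -
  have ratio: "(\<lambda>z. peval p z / peval q z) \<in> borel_measurable borel"
    by (rule borel_measurable_divide[OF peval_borel_measurable peval_borel_measurable])
  have "(\<integral>z. peval p z / peval q z \<partial>ambient (weighted q \<mu>)) =
      (\<integral>z. peval p z / peval q z \<partial>weighted q \<mu>)"
    unfolding ambient_def by (rule integral_distr[OF id_measurable_weighted ratio])
  also have "\<dots> = (\<integral>z. peval q z *\<^sub>R (peval p z / peval q z) \<partial>\<mu>)"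
    unfolding weighted_def
  proof (rule integral_density)
    show "AE z in \<mu>. 0 \<le> peval q z"
      using q_pos by (intro AE_I2) (simp add: space_borel_measures less_imp_le)
  qed (intro measurable_borel_measures ratio peval_borel_measurable)+
  also have "\<dots> = (\<integral>z. peval p z \<partial>\<mu>)"
    using q_pos by (intro Bochner_Integration.integral_cong) (force simp: space_borel_measures)+
  finally show ?thesis .
qed

lemma distr_ambient_weighted:
  assumes "L' \<subseteq> L"
  shows "distr (ambient (weighted q \<mu>)) borel (\<lambda>z. restrict z L') =
    distr (marginal L' (weighted q \<mu>)) borel (\<lambda>z. z)"
proof -
  have "measurable (weighted q \<mu>) (Pi\<^sub>M L' (\<lambda>_. borel :: real measure)) =
      measurable (restrict_space (Pi\<^sub>M L (\<lambda>_. borel)) A) (Pi\<^sub>M L' (\<lambda>_. borel))"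
    using \<mu> by (intro measurable_cong_sets) (auto simp: borel_measures_def weighted_def)
  then have "(\<lambda>z. restrict z L') \<in> weighted q \<mu> \<rightarrow>\<^sub>M Pi\<^sub>M L' (\<lambda>_. borel :: real measure)"
    using measurable_restrict_space1[OF measurable_restrict_subset[OF assms]] by simp
  then show ?thesis
    unfolding ambient_def marginal_def
    by (simp add: distr_distr id_measurable_PiM_borel id_measurable_weighted comp_def
        borel_measurable_continuous_onI[OF continuous_on_restrict_coordinates])
qed

end

section \<open>The feasible family of a point\<close>

text \<open>
  The Dirac measure at \<open>y\<close> divided by \<open>q y\<close>. Since \<^const>\<open>weighted\<close> multiplies by \<open>q\<close> again, the
  weighted measure is the Dirac measure itself.
\<close>

definition weighted_dirac :: "nat set \<Rightarrow> (nat \<Rightarrow> real) set \<Rightarrow> rpoly \<Rightarrow> (nat \<Rightarrow> real) \<Rightarrow> (nat \<Rightarrow> real) measure"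
  where "weighted_dirac L A q y =
    density (return (restrict_space (Pi\<^sub>M L (\<lambda>_. borel)) A) y) (\<lambda>z. ennreal (1 / peval q z))"

context
  fixes L :: "nat set" and A :: "(nat \<Rightarrow> real) set" and q :: rpoly and y :: "nat \<Rightarrow> real"
  assumes A_ext: "A \<subseteq> extensional L"
    and q_pos: "\<And>z. z \<in> A \<Longrightarrow> 0 < peval q z"
    and y: "y \<in> A"
begin

lemma weighted_dirac_borel_measures: "weighted_dirac L A q y \<in> borel_measures L A"
proof -
  let ?M = "restrict_space (Pi\<^sub>M L (\<lambda>_. borel :: real measure)) A"
  have [measurable]: "(\<lambda>z. 1 / peval q z) \<in> borel_measurable ?M"
    by (intro measurable_restrict_PiM) measurable
  have "emeasure (weighted_dirac L A q y) (space (weighted_dirac L A q y)) =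
      (\<integral>\<^sup>+z. ennreal (1 / peval q z) * indicator (space ?M) z \<partial>return ?M y)"
    unfolding weighted_dirac_def by (subst emeasure_density) auto
  also have "\<dots> = ennreal (1 / peval q y) * indicator (space ?M) y"
    by (rule nn_integral_return) (simp add: space_restrict_PiM[OF A_ext] y, measurable)
  also have "\<dots> = ennreal (1 / peval q y)"
    by (simp add: space_restrict_PiM[OF A_ext] y)
  finally have "emeasure (weighted_dirac L A q y) (space (weighted_dirac L A q y)) =
      ennreal (1 / peval q y)" .
  then show ?thesis
    by (auto simp: borel_measures_def weighted_dirac_def intro!: finite_measureI)
qed

lemma integral_weighted_dirac:
  "(\<integral>z. peval p z \<partial>weighted_dirac L A q y) = peval p y / peval q y"
proof -
  let ?M = "restrict_space (Pi\<^sub>M L (\<lambda>_. borel :: real measure)) A"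
  have "(\<integral>z. peval p z \<partial>weighted_dirac L A q y) = (\<integral>z. (1 / peval q z) *\<^sub>R peval p z \<partial>return ?M y)"
    unfolding weighted_dirac_def
  proof (rule integral_density)
    show "AE z in return ?M y. 0 \<le> 1 / peval q z"
      using q_pos by (intro AE_I2) (simp add: space_restrict_PiM[OF A_ext] less_imp_le)
  qed (simp_all add: measurable_restrict_PiM)
  also have "\<dots> = (1 / peval q y) *\<^sub>R peval p y"
    by (intro integral_return measurable_restrict_PiM) (auto simp: space_restrict_PiM[OF A_ext] y)
  finally show ?thesis
    by simp
qed

lemma weighted_weighted_dirac:
  "weighted q (weighted_dirac L A q y) = return (restrict_space (Pi\<^sub>M L (\<lambda>_. borel)) A) y"
proof -
  let ?M = "restrict_space (Pi\<^sub>M L (\<lambda>_. borel :: real measure)) A"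
  have "weighted q (weighted_dirac L A q y) =
      density (return ?M y) (\<lambda>z. ennreal (1 / peval q z) * ennreal (peval q z))"
    unfolding weighted_def weighted_dirac_def
    by (intro density_density_eq) (auto intro!: measurable_restrict_PiM)
  also have "\<dots> = density (return ?M y) (\<lambda>_. 1)"
  proof (intro density_cong AE_I2)
    fix z
    assume "z \<in> space (return ?M y)"
    then have "0 < peval q z"
      using q_pos by (simp add: space_restrict_PiM[OF A_ext])
    then show "ennreal (1 / peval q z) * ennreal (peval q z) = 1"
      by (simp flip: ennreal_mult)
  qed (auto intro!: measurable_restrict_PiM)
  also have "\<dots> = return ?M y"
    by (rule density_1)
  finally show ?thesis .
qed

lemma marginal_weighted_dirac:
  assumes "L' \<subseteq> L"
  shows "marginal L' (weighted q (weighted_dirac L A q y)) =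
    return (Pi\<^sub>M L' (\<lambda>_. borel)) (restrict y L')"
  unfolding weighted_weighted_dirac marginal_def using y
  by (intro distr_return measurable_restrict_space1 measurable_restrict_subset assms)
     (simp add: space_restrict_PiM[OF A_ext])

end

section \<open>Exactness of the relaxation\<close>

theorem theorem3p1:
  fixes n m N :: nat
    and g p q :: "nat \<Rightarrow> rpoly"
    and I J :: "nat \<Rightarrow> nat set"
    and M :: real
    and K :: "(nat \<Rightarrow> real) set"
    and KK :: "nat \<Rightarrow> (nat \<Rightarrow> real) set"
  assumes g_poly: "\<forall>j\<in>{1..m}. g j \<in> poly_ring {1..n}"
    and K_eq: "K = basic_set {1..n} {1..m} g"
    and K_compact: "compactin (product_topology (\<lambda>_. euclideanreal) {1..n}) K"
    and I_cover: "{1..n} = (\<Union>i\<in>{1..N}. I i)"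
    and M_pos: "M > 0"
    and M_bound: "\<forall>x\<in>K. M - (\<Sum>k=1..n. (x k)\<^sup>2) \<ge> 0"
    and g_ball: "\<forall>i\<in>{1..N}. g (m + i) = ball_poly M (I i)"
    and J_cover: "{1..m + N} = (\<Union>i\<in>{1..N}. J i)"
    and J_disjoint: "disjoint_family_on J {1..N}"
    and J_nonempty: "\<forall>i\<in>{1..N}. J i \<noteq> {}"
    and g_local: "\<forall>i\<in>{1..N}. \<forall>j\<in>J i. g j \<in> poly_ring (I i)"
    and KK_eq: "\<forall>i\<in>{1..N}. KK i = basic_set (I i) (J i) g"
    and p_local: "\<forall>i\<in>{1..N}. p i \<in> poly_ring (I i)"
    and q_local: "\<forall>i\<in>{1..N}. q i \<in> poly_ring (I i)"
    and q_pos: "\<forall>i\<in>{1..N}. \<forall>z\<in>KK i. peval (q i) z > 0"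
    and rip: "running_intersection N I"
  shows "f_hat N I KK p q = f_star N K p q"
proof -
  have I_sub: "I i \<subseteq> {1..n}" if "i \<in> {1..N}" for i
    using I_cover that by blast
  have fin_I: "finite (I i)" if "i \<in> {1..N}" for i
    using I_sub[OF that] finite_subset by blast
  have KK_ext: "KK i \<subseteq> extensional (I i)" if "i \<in> {1..N}" for i
    using KK_eq that by (auto simp: basic_set_def PiE_def)
  have KK_closed: "closed (KK i)" if "i \<in> {1..N}" for i
    using KK_eq that closed_basic_set by simp

  have in_K: "restrict x {1..n} \<in> K" if x: "\<And>i. i \<in> {1..N} \<Longrightarrow> restrict x (I i) \<in> KK i" for x
  proof -
    have "0 \<le> peval (g j) (restrict x {1..n})" if j: "j \<in> {1..m}" for j
    proof -
      have "j \<in> {1..m + N}"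
        using j by simp
      then obtain i where i: "i \<in> {1..N}" "j \<in> J i"
        using J_cover by blast
      have "0 \<le> peval (g j) (restrict x (I i))"
        using x[OF i(1)] KK_eq i by (auto simp: basic_set_def)
      also have "\<dots> = peval (g j) (restrict x {1..n})"
        using peval_restrict[of "g j" "I i" _ x] g_local i I_sub[OF i(1)] by simp
      finally show ?thesis .
    qed
    then show ?thesis
      by (simp add: K_eq basic_set_def)
  qed

  have in_KK: "restrict x (I i) \<in> KK i" if x: "x \<in> K" and i: "i \<in> {1..N}" for x i
  proof -
    have "0 \<le> peval (g j) (restrict x (I i))" if j: "j \<in> J i" for j
    proof -
      have gj: "peval (g j) (restrict x (I i)) = peval (g j) x"
        using g_local i j by (intro peval_restrict[of _ "I i"]) auto
      have "j \<in> {1..m + N}"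
        using J_cover i j by blast
      then have "j \<in> {1..m} \<or> (j - m \<in> {1..N} \<and> j = m + (j - m))"
        by auto
      then consider "j \<in> {1..m}" | k where "k \<in> {1..N}" "j = m + k"
        by blast
      then show ?thesis
      proof cases
        case 1
        then show ?thesis
          using x gj by (simp add: K_eq basic_set_def)
      next
        case 2
        have "(\<Sum>k\<in>I k. (x k)\<^sup>2) \<le> (\<Sum>k=1..n. (x k)\<^sup>2)"
          using I_sub[OF 2(1)] by (intro sum_mono2) auto
        also have "\<dots> \<le> M"
          using M_bound x by auto
        finally show ?thesis
          using g_ball 2 gj by (simp add: peval_ball_poly)
      qed
    qed
    then show ?thesis
      using KK_eq i by (simp add: basic_set_def)
  qed

  have "f_hat N I KK p q \<le> f_star N K p q"
    unfolding f_star_def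
  proof (rule INF_greatest)
    fix x
    assume x: "x \<in> K"
    define \<mu> where "\<mu> i = weighted_dirac (I i) (KK i) (q i) (restrict x (I i))" for i
    have dirac: "\<mu> i \<in> borel_measures (I i) (KK i)"
      "(\<integral>z. peval r z \<partial>\<mu> i) = peval r (restrict x (I i)) / peval (q i) (restrict x (I i))"
      "L \<subseteq> I i \<Longrightarrow> marginal L (weighted (q i) (\<mu> i)) = return (Pi\<^sub>M L (\<lambda>_. borel)) (restrict x L)"
      if i: "i \<in> {1..N}" for i r L
    proof -
      have q: "0 < peval (q i) z" if "z \<in> KK i" for z
        using q_pos i that by blast
      show "\<mu> i \<in> borel_measures (I i) (KK i)"
        unfolding \<mu>_def by (rule weighted_dirac_borel_measures[OF KK_ext[OF i] q in_KK[OF x i]])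
      show "(\<integral>z. peval r z \<partial>\<mu> i) = peval r (restrict x (I i)) / peval (q i) (restrict x (I i))"
        unfolding \<mu>_def by (rule integral_weighted_dirac[OF KK_ext[OF i] q in_KK[OF x i]])
      assume L: "L \<subseteq> I i"
      then have "restrict (restrict x (I i)) L = restrict x L"
        by (auto simp: fun_eq_iff)
      then show "marginal L (weighted (q i) (\<mu> i)) = return (Pi\<^sub>M L (\<lambda>_. borel)) (restrict x L)"
        unfolding \<mu>_def
        using marginal_weighted_dirac[OF KK_ext[OF i] q in_KK[OF x i] L] by simp
    qed
    have "peval (q i) (restrict x (I i)) \<noteq> 0" if "i \<in> {1..N}" for i
      using q_pos in_KK[OF x that] that by fastforce
    then have "\<mu> \<in> feasible N I KK q"
      using dirac by (auto simp: feasible_def later_neighbours_def)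
    moreover have "(\<Sum>i=1..N. \<integral>z. peval (p i) z \<partial>\<mu> i) = (\<Sum>i=1..N. peval (p i) x / peval (q i) x)"
    proof (intro sum.cong refl)
      fix i
      assume i: "i \<in> {1..N}"
      then have "peval (p i) (restrict x (I i)) = peval (p i) x"
        "peval (q i) (restrict x (I i)) = peval (q i) x"
        using p_local q_local by (auto intro!: peval_restrict)
      then show "(\<integral>z. peval (p i) z \<partial>\<mu> i) = peval (p i) x / peval (q i) x"
        using dirac(2)[OF i] by simp
    qed
    ultimately show "f_hat N I KK p q \<le> ereal (\<Sum>i=1..N. peval (p i) x / peval (q i) x)"
      unfolding f_hat_def by (intro INF_lower2[of \<mu>]) simp_all
  qed
  moreover have "f_star N K p q \<le> f_hat N I KK p q"
    unfolding f_hat_def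
  proof (rule INF_greatest)
    fix \<mu>
    assume feas: "\<mu> \<in> feasible N I KK q"
    define \<nu> where "\<nu> i = ambient (weighted (q i) (\<mu> i))" for i
    define A where "A i = {z \<in> KK i. (\<Sum>k\<in>I i. (z k)\<^sup>2) \<le> M}" for i
    have bm: "\<mu> i \<in> borel_measures (I i) (KK i)" if "i \<in> {1..N}" for i
      using feas that by (simp add: feasible_def)
    have q: "0 < peval (q i) z" if "i \<in> {1..N}" "z \<in> KK i" for i z
      using q_pos that by blast
    have prob: "prob_space (\<nu> i)" if "i \<in> {1..N}" for i
      unfolding \<nu>_def using feas that
      by (intro prob_space_ambient_weighted[OF bm[OF that] KK_ext[OF that] q[OF that]])
         (simp_all add: feasible_def)
    have AE_KK: "AE z in \<nu> i. z \<in> KK i" if "i \<in> {1..N}" for i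
      unfolding \<nu>_def
      by (rule AE_ambient_weighted[OF bm[OF that] KK_ext[OF that] KK_closed[OF that]])
    have integral: "(\<integral>z. peval (p i) z / peval (q i) z \<partial>\<nu> i) = (\<integral>z. peval (p i) z \<partial>\<mu> i)"
      if "i \<in> {1..N}" for i
      unfolding \<nu>_def by (rule integral_ambient_weighted[OF bm[OF that] KK_ext[OF that] q[OF that]])
    have marg: "distr (\<nu> i) borel (\<lambda>z. restrict z (I i \<inter> I j)) =
        distr (\<nu> j) borel (\<lambda>z. restrict z (I i \<inter> I j))"
      if ij: "1 \<le> i" "i < j" "j \<le> N" for i j
    proof -
      have i: "i \<in> {1..N}" and j: "j \<in> {1..N}"
        using ij by auto
      show ?thesis
      proof (cases "I i \<inter> I j = {}")
        case True
        \<comment> \<open>Feasibility says nothing about disjoint cliques, but the marginal on no variables only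
          records the total mass, which is \<open>1\<close> for both.\<close>
        have "(\<lambda>z. restrict z (I i \<inter> I j)) = (\<lambda>_ :: nat \<Rightarrow> real. \<lambda>_. undefined)"
          unfolding True by (auto simp: fun_eq_iff)
        then show ?thesis
          by (simp only: prob_space.distr_const[OF prob[OF i]] prob_space.distr_const[OF prob[OF j]]
              space_borel UNIV_I)
      next
        case False
        then have "j \<in> later_neighbours N I i" "i \<in> {1..N - 1}"
          using ij by (auto simp: later_neighbours_def)
        then have "marginal (I i \<inter> I j) (weighted (q i) (\<mu> i)) =
            marginal (I i \<inter> I j) (weighted (q j) (\<mu> j))"
          using feas unfolding feasible_def by blast
        moreover note distr_ambient_weighted[OF bm[OF i] KK_ext[OF i] Int_lower1]
          distr_ambient_weighted[OF bm[OF j] KK_ext[OF j] Int_lower2]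
        ultimately show ?thesis
          unfolding \<nu>_def by metis
      qed
    qed
    \<comment> \<open>\<open>KK i\<close> itself may be unbounded, because the ball constraint of \<open>I i\<close> may have been assigned to
      another \<open>J l\<close>. Then \<open>I i \<subseteq> I l\<close>, so \<open>\<nu> i\<close> is the full marginal of \<open>\<nu> l\<close> on \<open>I i\<close> and
      inherits the ball constraint from it.\<close>
    have AE_A: "AE z in \<nu> i. z \<in> A i" if i: "i \<in> {1..N}" for i
    proof -
      define P where "P = {z :: nat \<Rightarrow> real. (\<Sum>k\<in>I i. (z k)\<^sup>2) \<le> M}"
      have "closed P"
        unfolding P_def
        by (intro closed_Collect_le continuous_intros continuous_on_product_coordinates)
      then have P: "{z \<in> space borel. z \<in> P} \<in> sets borel"
        using borel_closed by simp
      have restr_P: "restrict z (I i) \<in> P \<longleftrightarrow> z \<in> P" for z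
        by (simp add: P_def)
      have "m + i \<in> {1..m + N}"
        using i by simp
      then obtain l where l: "l \<in> {1..N}" "m + i \<in> J l"
        using J_cover by blast
      have "I i \<subseteq> I l"
        using ball_poly_in_poly_ring_imp_subset[OF fin_I[OF i]] g_local g_ball i l by metis
      then have Int: "I i \<inter> I l = I i" "I l \<inter> I i = I i"
        by auto
      have "distr (\<nu> i) borel (\<lambda>z. restrict z (I i)) = distr (\<nu> l) borel (\<lambda>z. restrict z (I i))"
        using marg[of i l] marg[of l i] i l unfolding Int
        by (cases i l rule: linorder_cases) simp_all
      moreover have meas: "(\<lambda>z. restrict z (I i)) \<in> \<nu> k \<rightarrow>\<^sub>M borel" for k
      proof -
        have "measurable (\<nu> k) borel = measurable borel (borel :: (nat \<Rightarrow> real) measure)"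
          by (intro measurable_cong_sets) (simp_all add: \<nu>_def)
        then show ?thesis
          using borel_measurable_continuous_onI[OF continuous_on_restrict_coordinates] by blast
      qed
      moreover have "AE z in \<nu> l. z \<in> P"
        using AE_KK[OF l(1)]
      proof eventually_elim
        case (elim z)
        then have "0 \<le> peval (g (m + i)) z"
          using KK_eq l by (auto simp: basic_set_def)
        then show ?case
          using g_ball i by (simp add: peval_ball_poly P_def)
      qed
      ultimately have "AE z in \<nu> i. z \<in> P"
        using AE_distr_iff[OF meas P] unfolding restr_P by metis
      then show ?thesis
        using AE_KK[OF i] by (auto simp: A_def P_def)
    qed
    have compact_A: "compact (A i)" if i: "i \<in> {1..N}" for i
    proof -
      have "A i = {z \<in> extensional (I i). (\<Sum>k\<in>I i. (z k)\<^sup>2) \<le> M} \<inter> KK i"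
        using KK_ext[OF i] by (auto simp: A_def)
      then show ?thesis
        using compact_Int_closed[OF compact_extensional_ball[OF fin_I[OF i]] KK_closed[OF i]]
        by (simp only:)
    qed
    have "c \<le> (\<Sum>i=1..N. \<integral>z. peval (p i) z / peval (q i) z \<partial>\<nu> i)" if c: "ereal c \<le> f_star N K p q" for c
    proof (rule sum_integrals_lower_bound[OF rip prob _ marg compact_A _ AE_A])
      show "sets (\<nu> i) = sets borel" for i
        by (simp add: \<nu>_def)
      show "A i \<subseteq> extensional (I i)" if "i \<in> {1..N}" for i
        using KK_ext[OF that] by (auto simp: A_def)
      show "continuous_on (A i) (\<lambda>z. peval (p i) z / peval (q i) z)" if "i \<in> {1..N}" for i
        using q[OF that] by (intro continuous_on_divide continuous_on_peval) (force simp: A_def)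
      show "(\<lambda>z. peval (p i) z / peval (q i) z) \<in> borel_measurable borel" for i
        by (intro borel_measurable_divide peval_borel_measurable)
      fix x
      assume "\<And>i. i \<in> {1..N} \<Longrightarrow> restrict x (I i) \<in> A i"
      then have "restrict x {1..n} \<in> K"
        by (intro in_K) (simp add: A_def)
      then have "ereal c \<le> ereal (\<Sum>i=1..N. peval (p i) (restrict x {1..n}) / peval (q i) (restrict x {1..n}))"
        using c unfolding f_star_def by (rule order_trans[OF _ INF_lower, rotated])
      also have "(\<Sum>i=1..N. peval (p i) (restrict x {1..n}) / peval (q i) (restrict x {1..n})) =
          (\<Sum>i=1..N. peval (p i) (restrict x (I i)) / peval (q i) (restrict x (I i)))"
      proof (intro sum.cong refl)
        fix i
        assume i: "i \<in> {1..N}"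
        have "p i \<in> poly_ring (I i)" "q i \<in> poly_ring (I i)"
          using p_local q_local i by auto
        then show "peval (p i) (restrict x {1..n}) / peval (q i) (restrict x {1..n}) =
            peval (p i) (restrict x (I i)) / peval (q i) (restrict x (I i))"
          using peval_restrict I_sub[OF i] by (metis order_refl)
      qed
      finally show "c \<le> (\<Sum>i=1..N. peval (p i) (restrict x (I i)) / peval (q i) (restrict x (I i)))"
        by simp
    qed
    then have le: "c \<le> (\<Sum>i=1..N. \<integral>z. peval (p i) z \<partial>\<mu> i)" if "ereal c \<le> f_star N K p q" for c
      using that integral by simp
    show "f_star N K p q \<le> ereal (\<Sum>i=1..N. \<integral>z. peval (p i) z \<partial>\<mu> i)"
    proof (cases "f_star N K p q")
      case (real r)
      then show ?thesis
        using le[of r] by simp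
    next
      case PInf
      \<comment> \<open>Impossible: every real number would bound the objective from below. So for empty \<open>K\<close>
        there is no feasible family.\<close>
      then show ?thesis
        using le[of "(\<Sum>i=1..N. \<integral>z. peval (p i) z \<partial>\<mu> i) + 1"] by simp
    qed simp
  qed
  ultimately show ?thesis
    by (rule antisym)
qed

end
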